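(* Let $\nu\in\mathcal P_{2,0}(\mathbb R^d)$ and let $\mathcal D\subset\mathcal P_2(\mathbb R^d)$ be a cone which is either translation invariant or contained in $\mathcal P_{2,0}(\mathbb R^d)$. Then $$\operatorname{argmax}_{\mu\in\mathcal D\cap\mathcal M^K_\nu}\operatorname{Var}(\mu)=\operatorname{argmin}_{\mu\in\mathcal D}\mathcal W_2^2(\mu,\nu),$$ and the optimal values satisfy $\min_{\mu\in\mathcal D}\mathcal W_2^2(\mu,\nu)=\operatorname{Var}(\nu)-\max_{\mu\in\mathcal D\cap\mathcal M^K_\nu}\operatorname{Var}(\mu)$ whenever either side is attained.
   Context: $\mathcal P_2(\mathbb R^d)$: Borel probability measures with finite second moment; $\mathcal P_{2,0}$: those with zero mean. $\mathcal W_2$: quadratic Wasserstein distance. $\operatorname{Var}(\mu)=\int|x-\int z\,d\mu|^2d\mu$. Kantorovich dominance: $\mu\preceq_K\nu$ iff there is a coupling $\pi$ of $\mu,\nu$ with $\int\langle x-b_\nu,y-x\rangle\,d\pi=0$, $b_\nu=\int y\,d\nu$; $\mathcal M^K_\nu=\{\mu\in\mathcal P_2(\mathbb R^d):\mu\preceq_K\nu\}$. $\mathcal D$ is a cone if $\lambda_\#\mu\in\mathcal D$ (law of $\lambda X$, $X\sim\mu$) for all $\mu\in\mathcal D$, $\lambda\ge0$; translation invariant if $(T_k)_\#\mu\in\mathcal D$ for all $\mu\in\mathcal D$, $k\in\mathbb R^d$, with $T_k(x)=x+k$. *)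

theory Defs
  imports "HOL-Probability.Probability"
begin

definition P2 :: "('a::euclidean_space) measure set" where
  "P2 = {\<mu>. prob_space \<mu> \<and> sets \<mu> = sets borel \<and> integrable \<mu> (\<lambda>x. (norm x)\<^sup>2)}"

definition bary :: "('a::euclidean_space) measure \<Rightarrow> 'a" where
  "bary \<mu> = integral\<^sup>L \<mu> (\<lambda>x. x)"

definition P20 :: "('a::euclidean_space) measure set" where
  "P20 = {\<mu> \<in> P2. bary \<mu> = 0}"

definition Var :: "('a::euclidean_space) measure \<Rightarrow> real" where
  "Var \<mu> = integral\<^sup>L \<mu> (\<lambda>x. (norm (x - bary \<mu>))\<^sup>2)"

definition coupling :: "('a::euclidean_space) measure \<Rightarrow> 'a measure \<Rightarrow> ('a \<times> 'a) measure \<Rightarrow> bool" where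
  "coupling \<mu> \<nu> \<pi> \<longleftrightarrow> prob_space \<pi> \<and> sets \<pi> = sets (borel \<Otimes>\<^sub>M borel)
     \<and> distr \<pi> borel fst = \<mu> \<and> distr \<pi> borel snd = \<nu>"

definition W2sq :: "('a::euclidean_space) measure \<Rightarrow> 'a measure \<Rightarrow> real" where
  "W2sq \<mu> \<nu> = Inf {integral\<^sup>L \<pi> (\<lambda>(x,y). (norm (x - y))\<^sup>2) | \<pi>. coupling \<mu> \<nu> \<pi>}"

definition kdom :: "('a::euclidean_space) measure \<Rightarrow> 'a measure \<Rightarrow> bool" where
  "kdom \<mu> \<nu> \<longleftrightarrow> (\<exists>\<pi>. coupling \<mu> \<nu> \<pi>
      \<and> integrable \<pi> (\<lambda>(x,y). inner (x - bary \<nu>) (y - x))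
      \<and> integral\<^sup>L \<pi> (\<lambda>(x,y). inner (x - bary \<nu>) (y - x)) = 0)"

definition MK :: "('a::euclidean_space) measure \<Rightarrow> 'a measure set" where
  "MK \<nu> = {\<mu> \<in> P2. kdom \<mu> \<nu>}"

definition is_cone :: "('a::euclidean_space) measure set \<Rightarrow> bool" where
  "is_cone D \<longleftrightarrow> (\<forall>\<mu>\<in>D. \<forall>l::real. l \<ge> 0 \<longrightarrow> distr \<mu> borel (\<lambda>x. l *\<^sub>R x) \<in> D)"

definition transl_inv :: "('a::euclidean_space) measure set \<Rightarrow> bool" where
  "transl_inv D \<longleftrightarrow> (\<forall>\<mu>\<in>D. \<forall>k. distr \<mu> borel (\<lambda>x. x + k) \<in> D)"

definition argmax_on :: "('b \<Rightarrow> real) \<Rightarrow> 'b set \<Rightarrow> 'b set" where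
  "argmax_on f S = {x \<in> S. \<forall>y\<in>S. f y \<le> f x}"

definition argmin_on :: "('b \<Rightarrow> real) \<Rightarrow> 'b set \<Rightarrow> 'b set" where
  "argmin_on f S = {x \<in> S. \<forall>y\<in>S. f x \<le> f y}"

end

theory Submission
  imports Defs
begin

text \<open>Write \<open>c(\<pi>)\<close> for the integral of \<open>x \<bullet> y\<close> under a coupling \<open>\<pi>\<close> of \<open>\<mu>\<close> and \<open>\<nu>\<close>, and
  \<open>m\<close> for the second moment of \<open>\<mu>\<close>.  As \<open>\<nu>\<close> is centred, \<open>\<mu>\<close> is Kantorovich dominated iff
  \<open>c(\<pi>) = m\<close> for some \<open>\<pi>\<close>, and the transport cost of \<open>\<pi>\<close> is \<open>m + Var \<nu> - 2 c(\<pi>)\<close>.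
  Scaling \<open>\<mu>\<close> by \<open>l\<close> turns this into \<open>l^2 m + Var \<nu> - 2 l c(\<pi>)\<close>, which is minimal where the
  scaled measure satisfies the dominance identity, with value \<open>Var \<nu>\<close> minus the scaled second
  moment; centring \<open>\<mu>\<close> leaves \<open>c(\<pi>)\<close> unchanged and lowers \<open>m\<close> to the variance.

  That a minimizer is itself dominated needs an optimal coupling.  It is obtained from Prokhorov's
  theorem, which is reduced to Helly's theorem on the real line: a continuous curve
  \<open>\<gamma>\<close> fills the space, \<open>z \<mapsto> Inf {t \<ge> 0. \<gamma> t = z}\<close> is a Borel section
  of it (its sublevel sets are compact), and weak limits of the measures pushed to the line by
  the section are pushed back by \<open>\<gamma>\<close>.\<close>

section \<open>A space-filling curve\<close>

text \<open>A continuous digit reader: 0 up to 1/3, 1 from 2/3 on, linear between. On the Cantor set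
  it is half the leading ternary digit.\<close>

definition ternary_digit :: "real \<Rightarrow> real" where
  "ternary_digit t = max 0 (min 1 (3 * t - 1))"

text \<open>On the outer thirds of \<open>{0..1}\<close> this drops the leading ternary digit. On
  the middle third it equals \<open>2 - 3 * t\<close>, which joins the two branches
  continuously.\<close>

definition ternary_shift :: "real \<Rightarrow> real" where
  "ternary_shift t = 3 * t - 2 * ternary_digit t"

lemma ternary_digit_bounds: "0 \<le> ternary_digit t" "ternary_digit t \<le> 1"
  by (auto simp: ternary_digit_def)

lemma continuous_on_ternary_digit_funpow:
  "continuous_on UNIV (\<lambda>t. ternary_digit ((ternary_shift ^^ j) t))"
proof -
  have digit: "continuous_on UNIV ternary_digit"
    unfolding ternary_digit_def[abs_def] by (intro continuous_intros)
  have shift: "continuous_on UNIV ternary_shift"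
    unfolding ternary_shift_def[abs_def] by (intro continuous_intros digit)
  have "continuous_on UNIV (ternary_shift ^^ j)"
    by (induction j)
      (auto simp: id_def intro: continuous_on_compose2[OF shift] simp: o_def)
  then show ?thesis
    by (rule continuous_on_compose2[OF digit]) auto
qed

lemma ex_ternary_digits:
  "\<exists>t\<in>{0..1}. \<forall>j<n. ternary_digit ((ternary_shift ^^ j) t) = of_bool (d j)"
proof (induction n arbitrary: d)
  case 0
  then show ?case by (intro bexI[of _ 0]) auto
next
  case (Suc n)
  obtain t where t: "t \<in> {0..1}"
    "\<forall>j<n. ternary_digit ((ternary_shift ^^ j) t) = of_bool (d (Suc j))"
    using Suc.IH[of "\<lambda>j. d (Suc j)"] by blast
  \<comment> \<open>\<open>u\<close> prepends the ternary digit 0 or 2 to \<open>t\<close>: it lies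
    in the left or the right third, where the shift leads back to \<open>t\<close>.\<close>
  define u where "u = (2 * of_bool (d 0) + t) / 3"
  have d0: "ternary_digit u = of_bool (d 0)"
    using t(1) by (auto simp: u_def ternary_digit_def)
  have shift: "ternary_shift u = t"
    unfolding ternary_shift_def d0 by (simp add: u_def add_divide_distrib)
  have "ternary_digit ((ternary_shift ^^ j) u) = of_bool (d j)" if "j < Suc n" for j
    using that d0 shift t(2) by (cases j) (auto simp: funpow_swap1[symmetric] simp del: funpow.simps simp: funpow_Suc_right)
  moreover have "u \<in> {0..1}" using t(1) by (auto simp: u_def)
  ultimately show ?case by blast
qed

text \<open>Greedy expansion: the leading digit is 1 iff \<open>x \<ge> 1/2\<close>. Doubling and
  removing it leads back into \<open>{0..1}\<close>, so undoing the doubling halves the error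
  bound.\<close>

lemma ex_binary_digits:
  fixes x :: real
  assumes "x \<in> {0..1}"
  shows "\<exists>d. \<bar>x - (\<Sum>k<n. (1/2) ^ Suc k * of_bool (d k))\<bar> \<le> (1/2) ^ n"
  using assms
proof (induction n arbitrary: x)
  case 0
  then show ?case by auto
next
  case (Suc n)
  define c where "c = (x \<ge> 1/2)"
  have "2 * x - of_bool c \<in> {0..1}"
    using Suc.prems by (auto simp: c_def)
  from Suc.IH[OF this] obtain d where
    d: "\<bar>2 * x - of_bool c - (\<Sum>k<n. (1/2) ^ Suc k * of_bool (d k))\<bar> \<le> (1/2) ^ n" by blast
  have "(\<Sum>k<Suc n. (1/2) ^ Suc k * of_bool (case_nat c d k)) =
        (1/2) * (of_bool c + (\<Sum>k<n. (1/2) ^ Suc k * of_bool (d k)) :: real)"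
    unfolding sum.lessThan_Suc_shift by (simp add: sum_distrib_left field_simps)
  then have "x - (\<Sum>k<Suc n. (1/2) ^ Suc k * of_bool (case_nat c d k)) =
      (2 * x - of_bool c - (\<Sum>k<n. (1/2) ^ Suc k * of_bool (d k))) / 2"
    by (simp add: diff_divide_distrib del: sum.lessThan_Suc)
  then have "\<bar>x - (\<Sum>k<Suc n. (1/2) ^ Suc k * of_bool (case_nat c d k))\<bar> =
      \<bar>2 * x - of_bool c - (\<Sum>k<n. (1/2) ^ Suc k * of_bool (d k))\<bar> / 2"
    by (simp only: abs_divide abs_numeral)
  then have "\<bar>x - (\<Sum>k<Suc n. (1/2) ^ Suc k * of_bool (case_nat c d k))\<bar> \<le> (1/2) ^ Suc n"
    using d by simp
  then show ?case by blast
qed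

text \<open>A binary series whose digits are read at the ternary positions \<open>i\<close>,
  \<open>N + i\<close>, \<open>2 * N + i\<close>, and so on. The \<open>N\<close> residue classes
  are disjoint, so the coordinates can be prescribed independently. On \<open>{0..1}\<close> this is
  Schoenberg's space-filling curve.\<close>

definition curve_coord :: "nat \<Rightarrow> nat \<Rightarrow> real \<Rightarrow> real" where
  "curve_coord N i t = (\<Sum>k. (1/2) ^ Suc k * ternary_digit ((ternary_shift ^^ (k * N + i)) t))"

lemma norm_curve_term:
  "norm ((1/2) ^ Suc k * ternary_digit x) \<le> (1/2) ^ Suc k"
  using ternary_digit_bounds[of x] by (simp add: abs_mult)

lemma summable_half_powers: "summable (\<lambda>k. (1/2 :: real) ^ Suc k)"
  using power_half_series by (rule sums_summable)

lemma summable_curve_term: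
  "summable (\<lambda>k. (1/2) ^ Suc k * ternary_digit (f k))"
  by (rule summable_comparison_test'[OF summable_half_powers norm_curve_term])

lemma continuous_on_curve_coord: "continuous_on UNIV (curve_coord N i)"
proof -
  have "uniform_limit UNIV
      (\<lambda>n t. \<Sum>k<n. (1/2) ^ Suc k * ternary_digit ((ternary_shift ^^ (k * N + i)) t))
      (\<lambda>t. \<Sum>k. (1/2) ^ Suc k * ternary_digit ((ternary_shift ^^ (k * N + i)) t)) sequentially"
    by (rule Weierstrass_m_test[OF norm_curve_term summable_half_powers])
  then show ?thesis
    unfolding curve_coord_def[abs_def]
    by (rule uniform_limit_theorem[rotated])
      (auto intro!: always_eventually continuous_intros continuous_on_ternary_digit_funpow)
qed

text \<open>Terms below \<open>n\<close> match exactly, and the remaining ones are dominated by a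
  geometric tail of sum \<open>(1/2) ^ n\<close>.\<close>

lemma curve_coord_approx:
  assumes "\<And>k. k < n \<Longrightarrow> ternary_digit ((ternary_shift ^^ (k * N + i)) t) = of_bool (d k)"
  shows "\<bar>curve_coord N i t - (\<Sum>k<n. (1/2) ^ Suc k * of_bool (d k))\<bar> \<le> (1/2) ^ n"
proof -
  let ?a = "\<lambda>k. (1/2) ^ Suc k * ternary_digit ((ternary_shift ^^ (k * N + i)) t)"
  have "curve_coord N i t = (\<Sum>k. ?a (k + n)) + (\<Sum>k<n. ?a k)"
    unfolding curve_coord_def by (rule suminf_split_initial_segment[OF summable_curve_term])
  moreover have "(\<Sum>k<n. ?a k) = (\<Sum>k<n. (1/2) ^ Suc k * of_bool (d k))"
    using assms by (intro sum.cong) auto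
  moreover have "norm (\<Sum>k. ?a (k + n)) \<le> (\<Sum>k. (1/2) ^ n * (1/2) ^ Suc k)"
  proof (rule norm_suminf_le)
    show "norm (?a (k + n)) \<le> (1/2) ^ n * (1/2) ^ Suc k" for k
      using norm_curve_term[of "k + n"] by (simp only: power_add[symmetric] add_Suc_right add.commute)
    show "summable (\<lambda>k. (1/2 :: real) ^ n * (1/2) ^ Suc k)"
      by (intro summable_mult summable_half_powers)
  qed
  moreover have "(\<Sum>k. (1/2 :: real) ^ n * (1/2) ^ Suc k) = (1/2) ^ n"
    using power_half_series sums_unique suminf_mult[OF summable_half_powers] by fastforce
  ultimately show ?thesis by simp
qed

text \<open>\<open>to_nat_on\<close> numbers the basis vectors from 0 to \<open>DIM('a) - 1\<close>,
  giving each coordinate its own residue class of digit positions.\<close>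

definition cube_curve :: "real \<Rightarrow> 'a::euclidean_space" where
  "cube_curve t = (\<Sum>b\<in>Basis. curve_coord DIM('a) (to_nat_on (Basis :: 'a set) b) t *\<^sub>R b)"

lemma continuous_on_cube_curve: "continuous_on A cube_curve"
  unfolding cube_curve_def[abs_def]
  by (intro continuous_intros continuous_on_subset[OF continuous_on_curve_coord] subset_UNIV)

text \<open>Prescribing finitely many digits places the curve near any point of the cube; exact
  surjectivity then follows by compactness.\<close>

lemma cube_curve_approx:
  fixes z :: "'a::euclidean_space"
  assumes "z \<in> cbox 0 One"
  shows "\<exists>t\<in>{0..1}. dist (cube_curve t) z \<le> 2 * DIM('a) * (1/2) ^ n"
proof -
  let ?N = "DIM('a)"
  define ix where "ix = to_nat_on (Basis :: 'a set)"
  have bij: "bij_betw ix Basis {..<?N}"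
    unfolding ix_def by (rule to_nat_on_finite) simp
  have "\<forall>b\<in>Basis. \<exists>d. \<bar>z \<bullet> b - (\<Sum>k<n. (1/2) ^ Suc k * of_bool (d k))\<bar> \<le> (1/2) ^ n"
    using assms by (intro ballI ex_binary_digits) (auto simp: mem_box)
  from bchoice[OF this] obtain d where
    d: "\<forall>b\<in>Basis. \<bar>z \<bullet> b - (\<Sum>k<n. (1/2) ^ Suc k * of_bool (d b k))\<bar> \<le> (1/2) ^ n" ..
  \<comment> \<open>Interleaving: position \<open>j\<close> carries digit \<open>j div ?N\<close> of
    the coordinate with number \<open>j mod ?N\<close>.\<close>
  obtain t where t: "t \<in> {0..1}" "\<forall>j<n * ?N. ternary_digit ((ternary_shift ^^ j) t) =
      of_bool (d (inv_into Basis ix (j mod ?N)) (j div ?N))"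
    using ex_ternary_digits[of "n * ?N" "\<lambda>j. d (inv_into Basis ix (j mod ?N)) (j div ?N)"] by blast
  have "\<bar>(cube_curve t - z) \<bullet> b\<bar> \<le> 2 * (1/2) ^ n" if b: "b \<in> Basis" for b
  proof -
    have ib: "ix b < ?N" using bij b by (auto simp: bij_betw_def)
    have "ternary_digit ((ternary_shift ^^ (k * ?N + ix b)) t) = of_bool (d b k)" if "k < n" for k
    proof -
      have "Suc k * ?N \<le> n * ?N" using that by (intro mult_le_mono1) simp
      then have "k * ?N + ix b < n * ?N" using ib by simp
      then show ?thesis
        using t(2) ib bij b by (simp add: inv_into_f_f[OF bij_betw_imp_inj_on])
    qed
    from curve_coord_approx[OF this, of n]
    have "\<bar>curve_coord ?N (ix b) t - (\<Sum>k<n. (1/2) ^ Suc k * of_bool (d b k))\<bar> \<le> (1/2) ^ n" by simp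
    moreover have "cube_curve t \<bullet> b = curve_coord ?N (ix b) t"
      unfolding cube_curve_def ix_def using b by simp
    ultimately show ?thesis using bspec[OF d b] by (simp add: inner_diff_left)
  qed
  then have "norm (cube_curve t - z) \<le> (\<Sum>b\<in>(Basis::'a set). 2 * (1/2) ^ n)"
    by (intro order_trans[OF norm_le_l1] sum_mono) auto
  then show ?thesis using t(1) by (auto simp: dist_norm mult_ac)
qed

text \<open>The image of a compact interval is closed, and by the approximation it comes arbitrarily
  close to every point of the cube.\<close>

lemma cbox_subset_cube_curve: "cbox 0 One \<subseteq> cube_curve ` {0..1}"
proof
  fix z :: 'a
  assume z: "z \<in> cbox 0 One"
  have "closed (cube_curve ` {0..1::real} :: 'a set)"
    by (intro compact_imp_closed compact_continuous_image continuous_on_cube_curve) simp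
  moreover have "\<exists>y\<in>cube_curve ` {0..1}. dist y z < e" if "e > 0" for e
  proof -
    have "(\<lambda>n. 2 * DIM('a) * (1/2 :: real) ^ n) \<longlonglongrightarrow> 0"
      by (intro tendsto_mult_right_zero LIMSEQ_realpow_zero) auto
    then have "eventually (\<lambda>n. 2 * DIM('a) * (1/2 :: real) ^ n < e) sequentially"
      by (rule order_tendstoD) (use that in simp)
    then obtain n where "2 * DIM('a) * (1/2 :: real) ^ n < e"
      by (auto simp: eventually_sequentially)
    with cube_curve_approx[OF z, of n] show ?thesis by force
  qed
  ultimately show "z \<in> cube_curve ` {0..1}"
    by (subst closed_approachable[symmetric]) simp_all
qed

text \<open>The amplitude is constantly \<open>2 * n * pi\<close> on \<open>{2*n*pi..(2*n+1)*pi}\<close>, while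
  \<open>arccos (cos t)\<close> runs through \<open>{0..pi}\<close> there.\<close>

definition space_curve :: "real \<Rightarrow> 'a::euclidean_space" where
  "space_curve t = (t - arccos (cos t)) *\<^sub>R (2 *\<^sub>R cube_curve (arccos (cos t)) - One)"

lemma continuous_on_space_curve: "continuous_on A space_curve"
proof -
  have "continuous_on UNIV (\<lambda>t. arccos (cos t))"
    by (intro continuous_on_arccos continuous_intros) auto
  then have "continuous_on UNIV (space_curve :: real \<Rightarrow> 'a)"
    unfolding space_curve_def[abs_def]
    by (intro continuous_intros continuous_on_compose2[OF continuous_on_cube_curve[of UNIV]]) auto
  then show ?thesis by (rule continuous_on_subset) simp
qed

lemma cball_subset_space_curve: "\<exists>T\<ge>0. cball 0 R \<subseteq> space_curve ` {0..T}"
proof -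
  \<comment> \<open>\<open>n > 0\<close> makes the amplitude \<open>c\<close> below positive, so
    that \<open>z\<close> can be divided by it.\<close>
  obtain n :: nat where n: "R \<le> 2 * n * pi" "n > 0"
  proof -
    obtain n :: nat where "max R 1 < n" using reals_Archimedean2 by blast
    moreover have "real n * 1 \<le> n * (2 * pi)" using pi_gt3 by (intro mult_left_mono) auto
    then have "real n \<le> 2 * n * pi" by (simp add: mult_ac)
    ultimately have "R \<le> 2 * n * pi" "n > 0" by linarith+
    then show ?thesis by (rule that)
  qed
  define c where "c = 2 * real n * pi"
  have c: "c > 0" "R \<le> c" using n by (auto simp: c_def)
  have cos_c: "cos (s + c) = cos s" for s
    unfolding c_def by (simp only: cos_add cos_2npi sin_2npi mult_1_right mult_zero_right diff_0_right)
  have "z \<in> space_curve ` {0..c + 1}" if z: "z \<in> cball 0 R" for z :: 'a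
  proof -
    \<comment> \<open>\<open>w\<close> is the image of \<open>z\<close> under the affine map that
      takes the cube of half-width \<open>c\<close> around 0 to the unit cube.\<close>
    define w where "w = (1/2) *\<^sub>R (z /\<^sub>R c + One)"
    have zb: "0 \<le> c + z \<bullet> b" "z \<bullet> b \<le> c" if "b \<in> Basis" for b
      using Basis_le_norm[OF that, of z] z c by simp_all
    have "0 \<le> w \<bullet> b \<and> w \<bullet> b \<le> 1" if "b \<in> Basis" for b
      using zb[OF that] that c(1) by (simp add: w_def inner_add_left field_simps)
    then have "w \<in> cbox 0 One" by (simp add: mem_box)
    then obtain s where s: "s \<in> {0..1}" "cube_curve s = w"
      using cbox_subset_cube_curve by blast
    \<comment> \<open>As \<open>s \<le> 1 < pi\<close>, the time \<open>s + c\<close> falls in a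
      stretch where the amplitude of \<open>space_curve\<close> is exactly \<open>c\<close>.\<close>
    have "arccos (cos s) = s"
      using s(1) pi_gt3 by (intro arccos_cos) auto
    then have "arccos (cos (s + c)) = s" by (simp only: cos_c)
    then have "space_curve (s + c) = c *\<^sub>R (2 *\<^sub>R w - One)"
      by (simp only: space_curve_def s(2) add_diff_cancel_left')
    also have "2 *\<^sub>R w - One = z /\<^sub>R c"
      by (simp only: w_def scaleR_right_distrib scaleR_scaleR) simp
    also have "c *\<^sub>R (z /\<^sub>R c) = z"
      using c(1) by simp
    finally have "space_curve (s + c) = z" .
    moreover have "s + c \<in> {0..c + 1}" using s(1) c(1) by simp
    ultimately show ?thesis by blast
  qed
  then have "cball 0 R \<subseteq> (space_curve ` {0..c + 1} :: 'a set)" by (rule subsetI)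
  moreover have "0 \<le> c + 1" using c(1) by simp
  ultimately show ?thesis by blast
qed

section \<open>Weak limits of tight sequences\<close>

text \<open>The first time at which the curve visits \<open>z\<close>. Among all right inverses of
  the curve this choice makes measurability checkable through sublevel sets.\<close>

definition curve_section :: "'a::euclidean_space \<Rightarrow> real" where
  "curve_section z = Inf {t. 0 \<le> t \<and> space_curve t = z}"

lemma curve_section: "0 \<le> curve_section z" "space_curve (curve_section z) = z"
proof -
  let ?S = "{t. 0 \<le> t \<and> space_curve t = z}"
  obtain T where "cball 0 (norm z) \<subseteq> (space_curve ` {0..T} :: 'a set)"
    using cball_subset_space_curve by blast
  moreover have "z \<in> cball 0 (norm z)" by simp
  ultimately have "z \<in> space_curve ` {0..T}" by blast
  then have "?S \<noteq> {}" by auto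
  moreover have "closed ?S"
    by (intro closed_Collect_conj closed_Collect_le closed_Collect_eq continuous_on_space_curve continuous_intros)
  moreover have "bdd_below ?S" by (auto intro!: bdd_belowI[of _ 0])
  ultimately have "curve_section z \<in> ?S"
    unfolding curve_section_def by (intro closed_contains_Inf)
  then show "0 \<le> curve_section z" "space_curve (curve_section z) = z" by auto
qed

lemma curve_section_le_iff: "curve_section z \<le> a \<longleftrightarrow> z \<in> space_curve ` {0..a}"
proof
  assume "curve_section z \<le> a"
  then show "z \<in> space_curve ` {0..a}"
    using curve_section[of z] by (intro image_eqI[of _ _ "curve_section z"]) auto
next
  assume "z \<in> space_curve ` {0..a}"
  then obtain t where "0 \<le> t" "t \<le> a" "space_curve t = z" by auto
  moreover have "curve_section z \<le> t"
    unfolding curve_section_def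
    using calculation by (intro cInf_lower) (auto intro!: bdd_belowI[of _ 0])
  ultimately show "curve_section z \<le> a" by simp
qed

lemma measurable_curve_section [measurable]: "curve_section \<in> borel_measurable borel"
proof (rule borel_measurableI_le)
  fix a
  have "compact (space_curve ` {0..a} :: 'a set)"
    by (intro compact_continuous_image continuous_on_space_curve) simp
  then have "space_curve ` {0..a} \<in> sets (borel :: 'a measure)"
    by (intro borel_closed compact_imp_closed)
  then show "{z \<in> space borel. curve_section z \<le> a} \<in> sets (borel :: 'a measure)"
    by (simp add: curve_section_le_iff)
qed

theorem tight_imp_weakly_convergent_subseq:
  fixes \<rho> :: "nat \<Rightarrow> 'a::euclidean_space measure"
  assumes prob: "\<And>n. prob_space (\<rho> n)" and sets: "\<And>n. sets (\<rho> n) = sets borel"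
    and tight: "\<And>\<epsilon>. 0 < \<epsilon> \<Longrightarrow> \<exists>R. \<forall>n. 1 - \<epsilon> < measure (\<rho> n) (cball 0 R)"
  obtains r :: "nat \<Rightarrow> nat" and M where "strict_mono r" "prob_space M" "sets M = sets borel"
    "\<forall>(f :: 'a \<Rightarrow> real) B. continuous_on UNIV f \<longrightarrow> (\<forall>x. \<bar>f x\<bar> \<le> B) \<longrightarrow>
      (\<lambda>n. integral\<^sup>L (\<rho> (r n)) f) \<longlonglongrightarrow> integral\<^sup>L M f"
proof -
  have ms [measurable]: "curve_section \<in> borel_measurable (\<rho> n)" for n
    using measurable_curve_section by (simp cong: measurable_cong_sets add: sets)
  define m where "m n = distr (\<rho> n) borel curve_section" for n
  have rd: "real_distribution (m n)" for n
    unfolding m_def real_distribution_def real_distribution_axioms_def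
    by (simp add: prob_space.prob_space_distr[OF prob])
  have "\<exists>a b. a < b \<and> (\<forall>n. 1 - \<epsilon> < measure (m n) {a<..b})" if eps: "0 < \<epsilon>" for \<epsilon>
  proof -
    obtain R where R: "\<And>n. 1 - \<epsilon> < measure (\<rho> n) (cball 0 R)" using tight[OF eps] by blast
    obtain T where T: "0 \<le> T" "cball 0 R \<subseteq> (space_curve ` {0..T} :: 'a set)"
      using cball_subset_space_curve by blast
    \<comment> \<open>The left endpoint is -1 because \<open>tight\<close> uses intervals open on
      the left, while the section may take the value 0.\<close>
    have "1 - \<epsilon> < measure (m n) {-1<..T}" for n
    proof -
      interpret prob_space "\<rho> n" by (rule prob)
      have "curve_section z \<in> {-1<..T}" if "z \<in> cball 0 R" for z :: 'a
        using curve_section(1)[of z] curve_section_le_iff[of z T] T(2) that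
        by (auto intro: less_le_trans[of "-1" 0])
      then have "measure (\<rho> n) (cball 0 R) \<le> measure (\<rho> n) (curve_section -` {-1<..T} \<inter> space (\<rho> n))"
        using sets_eq_imp_space_eq[OF sets] by (intro finite_measure_mono measurable_sets[OF ms]) auto
      then show ?thesis using R[of n] by (simp add: m_def measure_distr)
    qed
    then show ?thesis using T(1) by (intro exI[of _ "-1"] exI[of _ T]) auto
  qed
  then have "tight m" using rd by (auto simp: tight_def)
  from tight_imp_convergent_subsubsequence[OF this strict_mono_id] obtain r L
    where r: "strict_mono r" and L: "real_distribution L" and conv: "weak_conv_m (m \<circ> r) L"
    by (auto simp: o_def)
  interpret L: real_distribution L by fact
  have mc [measurable]: "space_curve \<in> borel_measurable borel"
    by (intro borel_measurable_continuous_onI continuous_on_space_curve)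
  define M where "M = distr L borel (space_curve :: real \<Rightarrow> 'a)"
  show thesis
  proof (rule that[of r M])
    show "strict_mono r" by fact
    show "prob_space M" unfolding M_def by (rule L.prob_space_distr) simp
    show "sets M = sets borel" by (simp add: M_def)
    show "\<forall>(f :: 'a \<Rightarrow> real) B. continuous_on UNIV f \<longrightarrow> (\<forall>x. \<bar>f x\<bar> \<le> B) \<longrightarrow>
      (\<lambda>n. integral\<^sup>L (\<rho> (r n)) f) \<longlonglongrightarrow> integral\<^sup>L M f"
    proof (intro allI impI)
      fix f :: "'a \<Rightarrow> real" and B
      assume f: "continuous_on UNIV f" and B: "\<forall>x. \<bar>f x\<bar> \<le> B"
      have [measurable]: "f \<in> borel_measurable borel"
        using f by (rule borel_measurable_continuous_onI)
      \<comment> \<open>Weak convergence on the line is applied to \<open>f\<close> composed with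
        the continuous curve, as the section is only known to be Borel. Along the sequence the curve
        undoes the section and the integrals of \<open>f\<close> reappear.\<close>
      have "continuous_on UNIV (\<lambda>t. f (space_curve t))"
        by (rule continuous_on_compose2[OF f continuous_on_space_curve]) auto
      then have "(\<lambda>n. integral\<^sup>L ((m \<circ> r) n) (\<lambda>t. f (space_curve t))) \<longlonglongrightarrow> integral\<^sup>L L (\<lambda>t. f (space_curve t))"
        using rd L conv B
        by (intro weak_conv_imp_integral_bdd_continuous_conv[where B = B])
          (auto simp: continuous_on_eq_continuous_at o_def)
      moreover have "integral\<^sup>L ((m \<circ> r) n) (\<lambda>t. f (space_curve t)) = integral\<^sup>L (\<rho> (r n)) f" for n
        unfolding m_def o_def by (subst integral_distr) (auto simp: curve_section)
      moreover have "integral\<^sup>L L (\<lambda>t. f (space_curve t)) = integral\<^sup>L M f"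
        unfolding M_def by (subst integral_distr) auto
      ultimately show "(\<lambda>n. integral\<^sup>L (\<rho> (r n)) f) \<longlonglongrightarrow> integral\<^sup>L M f" by simp
    qed
  qed
qed

text \<open>The indicator of a nonempty closed set is the limit of the bumps
  \<open>max 0 (1 - real k * infdist x C)\<close>. Hence the measures agree on closed sets, an
  intersection-stable generator of the Borel sets.\<close>

lemma prob_measure_eqI_bounded_continuous:
  fixes M N :: "'a::metric_space measure"
  assumes "prob_space M" "prob_space N" and sets: "sets M = sets borel" "sets N = sets borel"
    and eq: "\<And>f :: 'a \<Rightarrow> real. continuous_on UNIV f \<Longrightarrow> (\<And>x. \<bar>f x\<bar> \<le> 1) \<Longrightarrow>
      integral\<^sup>L M f = integral\<^sup>L N f"
  shows "M = N"
proof -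
  interpret M: prob_space M by fact
  interpret N: prob_space N by fact
  have ind: "(\<lambda>k. integral\<^sup>L P (\<lambda>x. max 0 (1 - real k * infdist x C))) \<longlonglongrightarrow> measure P C"
    if C: "closed C" "C \<noteq> {}" and P: "prob_space P" "sets P = sets borel" for P :: "'a measure" and C
  proof -
    interpret P: prob_space P by fact
    have "(\<lambda>k. integral\<^sup>L P (\<lambda>x. max 0 (1 - real k * infdist x C))) \<longlonglongrightarrow> integral\<^sup>L P (indicator C :: 'a \<Rightarrow> real)"
    proof (rule integral_dominated_convergence[where w = "\<lambda>_. 1"])
      show "AE x in P. (\<lambda>k. max 0 (1 - real k * infdist x C)) \<longlonglongrightarrow> (indicator C x :: real)"
      proof (intro AE_I2)
        fix x
        show "(\<lambda>k. max 0 (1 - real k * infdist x C)) \<longlonglongrightarrow> (indicator C x :: real)"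
        proof (cases "x \<in> C")
          case True
          then show ?thesis by simp
        next
          case False
          then have pos: "0 < infdist x C" using C by (intro infdist_pos_not_in_closed) auto
          have "eventually (\<lambda>k. 1 / infdist x C \<le> real k) sequentially"
            by (metis eventually_sequentiallyI nat_ceiling_le_eq)
          then have "eventually (\<lambda>k. max 0 (1 - real k * infdist x C) = 0) sequentially"
            by eventually_elim (use pos in \<open>auto simp: field_simps\<close>)
          then show ?thesis using False by (auto intro: tendsto_eventually)
        qed
      qed
    qed (use C P in \<open>auto simp: infdist_nonneg borel_closed measurable_cong_sets[OF P(2) refl]
          intro!: borel_measurable_continuous_onI continuous_intros\<close>)
    then show ?thesis using C P by (simp add: borel_closed)
  qed
  have closed_eq: "emeasure M C = emeasure N C" if C: "closed C" for C
  \<comment> \<open>By convention \<open>infdist x {} = 0\<close>, so the bumps do not approximate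
    the indicator of the empty set.\<close>
  proof (cases "C = {}")
    case False
    have "integral\<^sup>L M (\<lambda>x. max 0 (1 - real k * infdist x C)) = integral\<^sup>L N (\<lambda>x. max 0 (1 - real k * infdist x C))" for k
      by (intro eq continuous_intros) (auto simp: infdist_nonneg)
    with ind[OF C False assms(1) sets(1)] ind[OF C False assms(2) sets(2)]
    have "measure M C = measure N C" by (simp add: LIMSEQ_unique)
    then show ?thesis by (simp add: M.emeasure_eq_measure N.emeasure_eq_measure)
  qed simp
  have "sets (borel :: 'a measure) = sigma_sets UNIV (Collect closed)"
    unfolding borel_eq_closed by simp
  then show ?thesis
    using closed_eq sets
    by (intro measure_eqI_generator_eq[where E = "Collect closed" and \<Omega> = UNIV and A = "\<lambda>_. UNIV"])
      (auto simp: Int_stable_def)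
qed

section \<open>Optimal couplings\<close>

lemma coupling_prob_space: "coupling \<mu> \<nu> \<pi> \<Longrightarrow> prob_space \<pi>"
  by (simp add: coupling_def)

text \<open>On a Euclidean space the product of the Borel algebras is the Borel algebra of the
  product, so the results on weak limits apply to couplings.\<close>

lemma coupling_sets: "coupling \<mu> \<nu> \<pi> \<Longrightarrow> sets \<pi> = sets borel"
  unfolding coupling_def borel_prod by simp

lemma coupling_measurable:
  assumes "coupling \<mu> \<nu> \<pi>" and "f \<in> borel \<Otimes>\<^sub>M borel \<rightarrow>\<^sub>M N"
  shows "f \<in> \<pi> \<rightarrow>\<^sub>M N"
  using assms measurable_cong_sets[of \<pi> "borel \<Otimes>\<^sub>M borel" N N] by (simp add: coupling_def)

lemma
  fixes g :: "'a::euclidean_space \<Rightarrow> 'b::{banach, second_countable_topology}"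
  assumes \<pi>: "coupling \<mu> \<nu> \<pi>" and [measurable]: "g \<in> borel_measurable borel"
  shows coupling_integrable_fst: "integrable \<pi> (\<lambda>z. g (fst z)) \<longleftrightarrow> integrable \<mu> g"
    and coupling_integrable_snd: "integrable \<pi> (\<lambda>z. g (snd z)) \<longleftrightarrow> integrable \<nu> g"
    and coupling_integral_fst: "integral\<^sup>L \<pi> (\<lambda>z. g (fst z)) = integral\<^sup>L \<mu> g"
    and coupling_integral_snd: "integral\<^sup>L \<pi> (\<lambda>z. g (snd z)) = integral\<^sup>L \<nu> g"
proof -
  have [measurable]: "fst \<in> \<pi> \<rightarrow>\<^sub>M borel" "snd \<in> \<pi> \<rightarrow>\<^sub>M borel"
    by (rule coupling_measurable[OF \<pi>], simp)+
  have eq: "\<mu> = distr \<pi> borel fst" "\<nu> = distr \<pi> borel snd"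
    using \<pi> by (auto simp: coupling_def)
  show "integrable \<pi> (\<lambda>z. g (fst z)) \<longleftrightarrow> integrable \<mu> g"
    unfolding eq(1) by (subst integrable_distr_eq) auto
  show "integrable \<pi> (\<lambda>z. g (snd z)) \<longleftrightarrow> integrable \<nu> g"
    unfolding eq(2) by (subst integrable_distr_eq) auto
  show "integral\<^sup>L \<pi> (\<lambda>z. g (fst z)) = integral\<^sup>L \<mu> g"
    unfolding eq(1) by (subst integral_distr) auto
  show "integral\<^sup>L \<pi> (\<lambda>z. g (snd z)) = integral\<^sup>L \<nu> g"
    unfolding eq(2) by (subst integral_distr) auto
qed

text \<open>The independent coupling shows that the infimum in \<open>W2sq\<close> ranges over a
  nonempty set; later it also serves as a competitor.\<close>

lemma coupling_pair_measure:
  assumes "prob_space \<mu>" "prob_space \<nu>" "sets \<mu> = sets borel" "sets \<nu> = sets borel"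
  shows "coupling \<mu> \<nu> (\<mu> \<Otimes>\<^sub>M \<nu>)"
proof -
  interpret \<mu>: prob_space \<mu> by fact
  interpret \<nu>: prob_space \<nu> by fact
  interpret pair_prob_space \<mu> \<nu> ..
  have "distr (\<mu> \<Otimes>\<^sub>M \<nu>) borel fst = distr (\<mu> \<Otimes>\<^sub>M \<nu>) \<mu> fst"
    by (rule distr_cong) (simp_all add: assms)
  moreover have "\<dots> = \<mu>" by (rule \<nu>.distr_pair_fst)
  moreover have "distr (\<mu> \<Otimes>\<^sub>M \<nu>) borel snd = \<nu>"
  proof (rule measure_eqI)
    fix A assume "A \<in> sets (distr (\<mu> \<Otimes>\<^sub>M \<nu>) borel snd)"
    then have A [measurable]: "A \<in> sets \<nu>" by (simp add: assms)
    have "snd -` A \<inter> space (\<mu> \<Otimes>\<^sub>M \<nu>) = space \<mu> \<times> A"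
      using sets.sets_into_space[OF A] by (auto simp: space_pair_measure)
    moreover have "snd \<in> \<mu> \<Otimes>\<^sub>M \<nu> \<rightarrow>\<^sub>M borel"
      using measurable_snd[of \<mu> \<nu>] measurable_cong_sets[of "\<mu> \<Otimes>\<^sub>M \<nu>" "\<mu> \<Otimes>\<^sub>M \<nu>" \<nu> borel] assms by simp
    ultimately have "emeasure (distr (\<mu> \<Otimes>\<^sub>M \<nu>) borel snd) A = emeasure (\<mu> \<Otimes>\<^sub>M \<nu>) (space \<mu> \<times> A)"
      using A assms(4) by (simp only: emeasure_distr)
    also have "\<dots> = emeasure \<mu> (space \<mu>) * emeasure \<nu> A"
      by (rule \<nu>.emeasure_pair_measure_Times[OF sets.top A])
    finally show "emeasure (distr (\<mu> \<Otimes>\<^sub>M \<nu>) borel snd) A = emeasure \<nu> A"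
      by (simp only: \<mu>.emeasure_space_1 mult_1_left)
  qed (simp add: assms)
  ultimately show ?thesis
    unfolding coupling_def using assms prob_space_axioms
    by (auto intro: sets_pair_measure_cong)
qed

lemma tight_single:
  fixes \<mu> :: "'a::euclidean_space measure"
  assumes "prob_space \<mu>" "sets \<mu> = sets borel" "0 < \<epsilon>"
  shows "\<exists>R. 1 - \<epsilon> < measure \<mu> (cball 0 R)"
proof -
  interpret prob_space \<mu> by fact
  have "(\<lambda>n. measure \<mu> (cball 0 (real n))) \<longlonglongrightarrow> measure \<mu> (\<Union>n. cball 0 (real n))"
    by (rule finite_Lim_measure_incseq) (auto simp: assms incseq_def borel_closed)
  moreover have "(\<Union>n. cball 0 (real n)) = (UNIV :: 'a set)"
    using real_arch_simple by auto
  ultimately have "(\<lambda>n. measure \<mu> (cball 0 (real n))) \<longlonglongrightarrow> 1"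
    using prob_space sets_eq_imp_space_eq[OF assms(2)] by simp
  then have "eventually (\<lambda>n. 1 - \<epsilon> < measure \<mu> (cball 0 (real n))) sequentially"
    by (rule order_tendstoD) (use assms(3) in simp)
  then show ?thesis by (auto simp: eventually_sequentially)
qed

text \<open>The mass a coupling puts outside a product of balls is controlled by its marginals
  alone, so one radius serves all couplings.\<close>

lemma couplings_tight:
  fixes \<mu> \<nu> :: "'a::euclidean_space measure"
  assumes "prob_space \<mu>" "prob_space \<nu>" "sets \<mu> = sets borel" "sets \<nu> = sets borel" "0 < \<epsilon>"
  shows "\<exists>R. \<forall>\<pi>. coupling \<mu> \<nu> \<pi> \<longrightarrow> 1 - \<epsilon> < measure \<pi> (cball 0 R)"
proof -
  obtain R1 where R1: "1 - \<epsilon>/2 < measure \<mu> (cball 0 R1)"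
    using tight_single[OF assms(1,3), of "\<epsilon>/2"] assms(5) by auto
  obtain R2 where R2: "1 - \<epsilon>/2 < measure \<nu> (cball 0 R2)"
    using tight_single[OF assms(2,4), of "\<epsilon>/2"] assms(5) by auto
  have "1 - \<epsilon> < measure \<pi> (cball 0 (R1 + R2))" if \<pi>: "coupling \<mu> \<nu> \<pi>" for \<pi>
  proof -
    interpret prob_space \<pi> by (rule coupling_prob_space[OF \<pi>])
    have [measurable]: "fst \<in> \<pi> \<rightarrow>\<^sub>M borel" "snd \<in> \<pi> \<rightarrow>\<^sub>M borel"
      by (rule coupling_measurable[OF \<pi>], simp)+
    have sp: "space \<pi> = UNIV" using sets_eq_imp_space_eq[OF coupling_sets[OF \<pi>]] by simp
    have A: "fst -` cball 0 R1 \<in> sets \<pi>" "snd -` cball 0 R2 \<in> sets \<pi>"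
      using measurable_sets[of fst \<pi> borel "cball 0 R1"] measurable_sets[of snd \<pi> borel "cball 0 R2"]
      by (simp_all add: sp borel_closed)
    have "measure \<pi> (fst -` cball 0 R1) = measure \<mu> (cball 0 R1)"
      "measure \<pi> (snd -` cball 0 R2) = measure \<nu> (cball 0 R2)"
      using \<pi> by (auto simp: coupling_def measure_distr sp borel_closed)
    \<comment> \<open>Bonferroni's inequality: P(A) + P(B) - 1 is at most P(A and B).\<close>
    moreover have "measure \<pi> (fst -` cball 0 R1) + measure \<pi> (snd -` cball 0 R2) - 1
        \<le> measure \<pi> (fst -` cball 0 R1 \<inter> snd -` cball 0 R2)"
      using finite_measure_Union'[OF A] finite_measure_Diff'[OF A(2) A(1)] prob_le_1[of "fst -` cball 0 R1 \<union> snd -` cball 0 R2"]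
      by (simp add: Int_commute)
    moreover have "measure \<pi> (fst -` cball 0 R1 \<inter> snd -` cball 0 R2) \<le> measure \<pi> (cball 0 (R1 + R2))"
    proof (rule finite_measure_mono)
      show "fst -` cball 0 R1 \<inter> snd -` cball 0 R2 \<subseteq> (cball 0 (R1 + R2) :: ('a \<times> 'a) set)"
        by (auto intro!: order_trans[OF norm_Pair_le] add_mono)
      show "cball 0 (R1 + R2) \<in> sets \<pi>" by (simp add: coupling_sets[OF \<pi>] borel_closed)
    qed
    ultimately show ?thesis using R1 R2 by simp
  qed
  then show ?thesis by blast
qed

section \<open>Moments and the transport cost of a coupling\<close>

definition second_moment :: "'a::euclidean_space measure \<Rightarrow> real" where
  "second_moment \<mu> = integral\<^sup>L \<mu> (\<lambda>x. (norm x)\<^sup>2)"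

definition cross_moment :: "('a::euclidean_space \<times> 'a) measure \<Rightarrow> real" where
  "cross_moment \<pi> = integral\<^sup>L \<pi> (\<lambda>z. fst z \<bullet> snd z)"

lemma P2D:
  assumes "\<mu> \<in> P2"
  shows "prob_space \<mu>" "sets \<mu> = sets borel" "integrable \<mu> (\<lambda>x. (norm x)\<^sup>2)" "integrable \<mu> (\<lambda>x. x)"
proof -
  show *: "prob_space \<mu>" "sets \<mu> = sets borel" "integrable \<mu> (\<lambda>x. (norm x)\<^sup>2)"
    using assms by (auto simp: P2_def)
  interpret prob_space \<mu> by fact
  show "integrable \<mu> (\<lambda>x. x)"
  proof (rule Bochner_Integration.integrable_bound)
    show "integrable \<mu> (\<lambda>x. 1 + (norm x)\<^sup>2)" using * by simp
    show "(\<lambda>x. x) \<in> borel_measurable \<mu>"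
      using measurable_ident_sets[OF *(2)] by simp
    show "AE x in \<mu>. norm x \<le> norm (1 + (norm x)\<^sup>2)"
    proof (intro AE_I2)
      fix x :: 'a
      have "0 \<le> (norm x - 1)\<^sup>2" by simp
      then have "2 * norm x \<le> 1 + (norm x)\<^sup>2" by (simp add: power2_eq_square algebra_simps)
      then show "norm x \<le> norm (1 + (norm x)\<^sup>2)" using norm_ge_zero[of x] by (simp del: norm_ge_zero)
    qed
  qed
qed

lemma second_moment_nonneg: "0 \<le> second_moment \<mu>"
  by (simp add: second_moment_def)

lemma
  assumes "\<mu> \<in> P2"
  shows second_moment_shift:
      "integral\<^sup>L \<mu> (\<lambda>x. (norm (x - k))\<^sup>2) = second_moment \<mu> - 2 * (bary \<mu> \<bullet> k) + (norm k)\<^sup>2"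
    and integrable_shift: "integrable \<mu> (\<lambda>x. (norm (x - k))\<^sup>2)"
proof -
  interpret prob_space \<mu> by (rule P2D[OF assms])
  have eq: "(\<lambda>x. (norm (x - k))\<^sup>2) = (\<lambda>x. (norm x)\<^sup>2 - 2 * (x \<bullet> k) + (norm k)\<^sup>2)"
    by (simp add: fun_eq_iff power2_norm_eq_inner inner_diff_left inner_diff_right inner_commute algebra_simps)
  show "integral\<^sup>L \<mu> (\<lambda>x. (norm (x - k))\<^sup>2) = second_moment \<mu> - 2 * (bary \<mu> \<bullet> k) + (norm k)\<^sup>2"
    unfolding eq second_moment_def bary_def using P2D(3,4)[OF assms] by (simp add: prob_space)
  show "integrable \<mu> (\<lambda>x. (norm (x - k))\<^sup>2)"
    unfolding eq using P2D(3,4)[OF assms] by simp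
qed

lemma Var_eq:
  assumes "\<mu> \<in> P2"
  shows "Var \<mu> = second_moment \<mu> - (norm (bary \<mu>))\<^sup>2"
  unfolding Var_def second_moment_shift[OF assms] by (simp add: power2_norm_eq_inner)

text \<open>The square of the distance is expanded; the mixed term is integrable by Cauchy-Schwarz
  and the bound of twice a product by the sum of squares. With fixed marginals only the cross moment
  varies.\<close>

lemma
  assumes "\<mu> \<in> P2" "\<nu> \<in> P2" and \<pi>: "coupling \<mu> \<nu> \<pi>"
  shows integrable_cross: "integrable \<pi> (\<lambda>z. fst z \<bullet> snd z)"
    and integrable_cost: "integrable \<pi> (\<lambda>(x, y). (norm (x - y))\<^sup>2)"
    and integral_cost: "integral\<^sup>L \<pi> (\<lambda>(x, y). (norm (x - y))\<^sup>2) =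
      second_moment \<mu> + second_moment \<nu> - 2 * cross_moment \<pi>"
proof -
  have int: "integrable \<pi> (\<lambda>z. (norm (fst z))\<^sup>2)" "integrable \<pi> (\<lambda>z. (norm (snd z))\<^sup>2)"
    using P2D(3)[OF assms(1)] P2D(3)[OF assms(2)]
    by (simp_all add: coupling_integrable_fst[OF \<pi>, where g = "\<lambda>x. (norm x)\<^sup>2"]
      coupling_integrable_snd[OF \<pi>, where g = "\<lambda>x. (norm x)\<^sup>2"])
  show cross: "integrable \<pi> (\<lambda>z. fst z \<bullet> snd z)"
  proof (rule Bochner_Integration.integrable_bound)
    show "integrable \<pi> (\<lambda>z. (norm (fst z))\<^sup>2 + (norm (snd z))\<^sup>2)" using int by simp
    show "(\<lambda>z. fst z \<bullet> snd z) \<in> borel_measurable \<pi>"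
      by (rule coupling_measurable[OF \<pi>]) simp
    show "AE z in \<pi>. norm (fst z \<bullet> snd z) \<le> norm ((norm (fst z))\<^sup>2 + (norm (snd z))\<^sup>2)"
    proof (intro AE_I2)
      fix z :: "'a \<times> 'a"
      have "\<bar>fst z \<bullet> snd z\<bar> \<le> norm (fst z) * norm (snd z)" by (rule Cauchy_Schwarz_ineq2)
      moreover have "2 * norm (fst z) * norm (snd z) \<le> (norm (fst z))\<^sup>2 + (norm (snd z))\<^sup>2"
        by (rule sum_squares_bound)
      moreover have "0 \<le> norm (fst z) * norm (snd z)" by simp
      ultimately show "norm (fst z \<bullet> snd z) \<le> norm ((norm (fst z))\<^sup>2 + (norm (snd z))\<^sup>2)"
        by simp
    qed
  qed
  have eq: "(\<lambda>(x, y). (norm (x - y))\<^sup>2) =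
      (\<lambda>z :: 'a \<times> 'a. (norm (fst z))\<^sup>2 + (norm (snd z))\<^sup>2 - 2 * (fst z \<bullet> snd z))"
    by (auto simp: fun_eq_iff power2_norm_eq_inner inner_diff_left inner_diff_right inner_commute)
  show "integrable \<pi> (\<lambda>(x, y). (norm (x - y))\<^sup>2)"
    unfolding eq using int cross by simp
  show "integral\<^sup>L \<pi> (\<lambda>(x, y). (norm (x - y))\<^sup>2) =
      second_moment \<mu> + second_moment \<nu> - 2 * cross_moment \<pi>"
    unfolding eq cross_moment_def second_moment_def using int cross
    by (simp add: coupling_integral_fst[OF \<pi>, where g = "\<lambda>x. (norm x)\<^sup>2"]
      coupling_integral_snd[OF \<pi>, where g = "\<lambda>x. (norm x)\<^sup>2"])
qed

lemma W2sq_le_cost: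
  assumes "coupling \<mu> \<nu> \<pi>"
  shows "W2sq \<mu> \<nu> \<le> integral\<^sup>L \<pi> (\<lambda>(x, y). (norm (x - y))\<^sup>2)"
  unfolding W2sq_def
proof (rule cInf_lower)
  show "bdd_below {integral\<^sup>L \<pi> (\<lambda>(x, y). (norm (x - y))\<^sup>2) | \<pi>. coupling \<mu> \<nu> \<pi>}"
    by (rule bdd_belowI[of _ 0]) (auto intro!: integral_nonneg_AE)
qed (use assms in blast)

text \<open>The direct method: a minimizing sequence of couplings has a weak limit with the same
  marginals. The cost is unbounded, so its semicontinuity is obtained through truncations.\<close>

theorem optimal_coupling_exists:
  fixes \<mu> \<nu> :: "'a::euclidean_space measure"
  assumes \<mu>: "\<mu> \<in> P2" and \<nu>: "\<nu> \<in> P2"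
  obtains \<pi> where "coupling \<mu> \<nu> \<pi>" "W2sq \<mu> \<nu> = integral\<^sup>L \<pi> (\<lambda>(x, y). (norm (x - y))\<^sup>2)"
proof -
  let ?c = "\<lambda>(x :: 'a, y). (norm (x - y))\<^sup>2"
  let ?S = "{integral\<^sup>L \<pi> ?c | \<pi>. coupling \<mu> \<nu> \<pi>}"
  have "\<forall>n. \<exists>\<pi>. coupling \<mu> \<nu> \<pi> \<and> integral\<^sup>L \<pi> ?c < W2sq \<mu> \<nu> + inverse (real (Suc n))"
  proof
    fix n
    have "?S \<noteq> {}" using coupling_pair_measure P2D[OF \<mu>] P2D[OF \<nu>] by blast
    moreover have "Inf ?S < W2sq \<mu> \<nu> + inverse (real (Suc n))" by (simp add: W2sq_def)
    ultimately show "\<exists>\<pi>. coupling \<mu> \<nu> \<pi> \<and> integral\<^sup>L \<pi> ?c < W2sq \<mu> \<nu> + inverse (real (Suc n))"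
      using cInf_lessD[of ?S] by blast
  qed
  from choice[OF this] obtain p where p: "\<And>n. coupling \<mu> \<nu> (p n)"
    and p_le: "\<And>n. integral\<^sup>L (p n) ?c < W2sq \<mu> \<nu> + inverse (real (Suc n))" by blast
  have tight: "\<exists>R. \<forall>n. 1 - \<epsilon> < measure (p n) (cball 0 R)" if "0 < \<epsilon>" for \<epsilon>
    using couplings_tight[OF P2D(1)[OF \<mu>] P2D(1)[OF \<nu>] P2D(2)[OF \<mu>] P2D(2)[OF \<nu>] that] p by blast
  obtain r \<pi> where r: "strict_mono r" and \<pi>: "prob_space \<pi>" "sets \<pi> = sets borel"
    and conv': "\<forall>(f :: 'a \<times> 'a \<Rightarrow> real) B. continuous_on UNIV f \<longrightarrow> (\<forall>x. \<bar>f x\<bar> \<le> B) \<longrightarrow>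
      (\<lambda>n. integral\<^sup>L (p (r n)) f) \<longlonglongrightarrow> integral\<^sup>L \<pi> f"
    by (rule tight_imp_weakly_convergent_subseq[where \<rho> = p,
          OF coupling_prob_space[OF p] coupling_sets[OF p] tight])
  have conv: "(\<lambda>n. integral\<^sup>L (p (r n)) f) \<longlonglongrightarrow> integral\<^sup>L \<pi> f"
    if "continuous_on UNIV f" "\<And>x. \<bar>f x\<bar> \<le> B" for f :: "'a \<times> 'a \<Rightarrow> real" and B
    using that by (rule conv'[rule_format])
  interpret prob_space \<pi> by fact
  have [measurable]: "fst \<in> \<pi> \<rightarrow>\<^sub>M borel" "snd \<in> \<pi> \<rightarrow>\<^sub>M borel"
    unfolding measurable_cong_sets[OF \<pi>(2) refl]
    by (rule borel_measurable_continuous_onI[OF continuous_on_fst[OF continuous_on_id]]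
        borel_measurable_continuous_onI[OF continuous_on_snd[OF continuous_on_id]])+
  have "distr \<pi> borel fst = \<mu>"
  proof (rule prob_measure_eqI_bounded_continuous)
    fix f :: "'a \<Rightarrow> real" assume f: "continuous_on UNIV f" "\<And>x. \<bar>f x\<bar> \<le> 1"
    then have [measurable]: "f \<in> borel_measurable borel" by (intro borel_measurable_continuous_onI)
    \<comment> \<open>Along the sequence this integral is constantly
      \<open>integral\<^sup>L \<mu> f\<close>, so the marginal survives in the limit.\<close>
    have "(\<lambda>n. integral\<^sup>L (p (r n)) (\<lambda>z. f (fst z))) \<longlonglongrightarrow> integral\<^sup>L \<pi> (\<lambda>z. f (fst z))"
      by (rule conv[of _ 1], rule continuous_on_compose2[OF f(1) continuous_on_fst[OF continuous_on_id]])
        (use f(2) in auto)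
    then have "integral\<^sup>L \<mu> f = integral\<^sup>L \<pi> (\<lambda>z. f (fst z))"
      unfolding coupling_integral_fst[OF p \<open>f \<in> borel_measurable borel\<close>] LIMSEQ_const_iff .
    then show "integral\<^sup>L (distr \<pi> borel fst) f = integral\<^sup>L \<mu> f"
      by (subst integral_distr) auto
  next
    show "prob_space (distr \<pi> borel fst)" by (rule prob_space_distr) measurable
  qed (use P2D(1,2)[OF \<mu>] in simp_all)
  moreover have "distr \<pi> borel snd = \<nu>"
  proof (rule prob_measure_eqI_bounded_continuous)
    fix f :: "'a \<Rightarrow> real" assume f: "continuous_on UNIV f" "\<And>x. \<bar>f x\<bar> \<le> 1"
    then have [measurable]: "f \<in> borel_measurable borel" by (intro borel_measurable_continuous_onI)
    have "(\<lambda>n. integral\<^sup>L (p (r n)) (\<lambda>z. f (snd z))) \<longlonglongrightarrow> integral\<^sup>L \<pi> (\<lambda>z. f (snd z))"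
      by (rule conv[of _ 1], rule continuous_on_compose2[OF f(1) continuous_on_snd[OF continuous_on_id]])
        (use f(2) in auto)
    then have "integral\<^sup>L \<nu> f = integral\<^sup>L \<pi> (\<lambda>z. f (snd z))"
      unfolding coupling_integral_snd[OF p \<open>f \<in> borel_measurable borel\<close>] LIMSEQ_const_iff .
    then show "integral\<^sup>L (distr \<pi> borel snd) f = integral\<^sup>L \<nu> f"
      by (subst integral_distr) auto
  next
    show "prob_space (distr \<pi> borel snd)" by (rule prob_space_distr) measurable
  qed (use P2D(1,2)[OF \<nu>] in simp_all)
  ultimately have coup: "coupling \<mu> \<nu> \<pi>"
    using \<pi> unfolding coupling_def borel_prod by simp
  have cc: "continuous_on UNIV ?c"
    by (simp add: split_beta') (intro continuous_intros)
  \<comment> \<open>The cost cut off at \<open>k\<close> is bounded and continuous, so its integrals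
    converge; each is at most the full cost along the minimizing sequence.\<close>
  have trunc: "integral\<^sup>L \<pi> (\<lambda>z. min (?c z) (real k)) \<le> W2sq \<mu> \<nu>" for k
  proof (rule LIMSEQ_le)
    show "(\<lambda>n. integral\<^sup>L (p (r n)) (\<lambda>z. min (?c z) (real k))) \<longlonglongrightarrow> integral\<^sup>L \<pi> (\<lambda>z. min (?c z) (real k))"
      by (rule conv[of _ "real k"]) (auto intro!: continuous_on_min cc continuous_on_const)
    show "(\<lambda>n. W2sq \<mu> \<nu> + inverse (real (Suc n))) \<longlonglongrightarrow> W2sq \<mu> \<nu>"
      using tendsto_add[OF tendsto_const LIMSEQ_inverse_real_of_nat] by simp
    have "integral\<^sup>L (p (r n)) (\<lambda>z. min (?c z) (real k)) \<le> W2sq \<mu> \<nu> + inverse (real (Suc n))" for n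
    proof -
      have int: "integrable (p (r n)) ?c" by (rule integrable_cost[OF \<mu> \<nu> p])
      have "integral\<^sup>L (p (r n)) (\<lambda>z. min (?c z) (real k)) \<le> integral\<^sup>L (p (r n)) ?c"
      proof (rule integral_mono)
        interpret pr: prob_space "p (r n)" by (rule coupling_prob_space[OF p])
        show "integrable (p (r n)) (\<lambda>z. min (?c z) (real k))"
          by (intro integrable_min int) simp
      qed (auto intro: int)
      also have "\<dots> \<le> W2sq \<mu> \<nu> + inverse (real (Suc (r n)))" using p_le by (rule less_imp_le)
      also have "\<dots> \<le> W2sq \<mu> \<nu> + inverse (real (Suc n))"
        using seq_suble[OF r, of n] by (intro add_left_mono le_imp_inverse_le) auto
      finally show ?thesis .
    qed
    then show "\<exists>N. \<forall>n\<ge>N. integral\<^sup>L (p (r n)) (\<lambda>z. min (?c z) (real k)) \<le> W2sq \<mu> \<nu> + inverse (real (Suc n))"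
      by blast
  qed
  \<comment> \<open>The limit is a coupling of measures in \<open>P2\<close>, so the cost is
    integrable and can dominate its own truncations as \<open>k\<close> grows.\<close>
  have int: "integrable \<pi> ?c" by (rule integrable_cost[OF \<mu> \<nu> coup])
  have "(\<lambda>k. integral\<^sup>L \<pi> (\<lambda>z. min (?c z) (real k))) \<longlonglongrightarrow> integral\<^sup>L \<pi> ?c"
  proof (rule integral_dominated_convergence[where w = ?c])
    show "AE z in \<pi>. (\<lambda>k. min (?c z) (real k)) \<longlonglongrightarrow> ?c z"
    proof (intro AE_I2 tendsto_eventually)
      fix z
      show "eventually (\<lambda>k. min (?c z) (real k) = ?c z) sequentially"
        using eventually_ge_at_top[of "nat \<lceil>?c z\<rceil>"]
        by eventually_elim (simp add: nat_ceiling_le_eq min_def)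
    qed
    show "?c \<in> borel_measurable \<pi>" using int by (rule borel_measurable_integrable)
    then show "(\<lambda>z. min (?c z) (real k)) \<in> borel_measurable \<pi>" for k
      by (intro borel_measurable_min) auto
  qed (auto intro: int)
  then have "integral\<^sup>L \<pi> ?c \<le> W2sq \<mu> \<nu>"
    by (rule LIMSEQ_le_const2) (use trunc in blast)
  with W2sq_le_cost[OF coup] coup show thesis by (intro that) auto
qed

section \<open>Scaling, centring and dominance\<close>

lemma P2_distr:
  assumes "prob_space \<mu>" "sets \<mu> = sets borel" and [measurable]: "f \<in> borel_measurable borel"
    and "integrable \<mu> (\<lambda>x. (norm (f x))\<^sup>2)"
  shows "distr \<mu> borel f \<in> P2"
proof -
  have [measurable]: "f \<in> borel_measurable \<mu>"
    using assms(3) by (simp add: measurable_cong_sets[OF assms(2) refl])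
  show ?thesis
    using assms by (auto simp: P2_def integrable_distr_eq intro: prob_space.prob_space_distr)
qed

lemma second_moment_distr:
  assumes "sets \<mu> = sets borel" and [measurable]: "f \<in> borel_measurable borel"
  shows "second_moment (distr \<mu> borel f) = integral\<^sup>L \<mu> (\<lambda>x. (norm (f x))\<^sup>2)"
proof -
  have [measurable]: "f \<in> borel_measurable \<mu>"
    using assms(2) by (simp add: measurable_cong_sets[OF assms(1) refl])
  show ?thesis unfolding second_moment_def by (subst integral_distr) auto
qed

lemma bary_distr:
  assumes "sets \<mu> = sets borel" and [measurable]: "f \<in> borel_measurable borel"
  shows "bary (distr \<mu> borel f) = integral\<^sup>L \<mu> f"
proof -
  have [measurable]: "f \<in> borel_measurable \<mu>"
    using assms(2) by (simp add: measurable_cong_sets[OF assms(1) refl])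
  show ?thesis unfolding bary_def by (subst integral_distr) auto
qed

text \<open>Moving only the first coordinate of a coupling turns a coupling for \<open>\<mu>\<close>
  into one for its image; scaling and centring are both instances.\<close>

lemma coupling_map_fst:
  assumes \<pi>: "coupling \<mu> \<nu> \<pi>" and [measurable]: "f \<in> borel_measurable borel"
  defines "\<pi>' \<equiv> distr \<pi> (borel \<Otimes>\<^sub>M borel) (\<lambda>z. (f (fst z), snd z))"
  shows "coupling (distr \<mu> borel f) \<nu> \<pi>'"
    and "cross_moment \<pi>' = integral\<^sup>L \<pi> (\<lambda>z. f (fst z) \<bullet> snd z)"
proof -
  have [measurable]: "(\<lambda>z. (f (fst z), snd z)) \<in> \<pi> \<rightarrow>\<^sub>M borel \<Otimes>\<^sub>M borel"
    "fst \<in> \<pi> \<rightarrow>\<^sub>M borel" "snd \<in> \<pi> \<rightarrow>\<^sub>M borel"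
    by (rule coupling_measurable[OF \<pi>], measurable)+
  have \<pi>_eq: "\<mu> = distr \<pi> borel fst" "\<nu> = distr \<pi> borel snd"
    using \<pi> by (auto simp: coupling_def)
  have "distr \<pi>' borel fst = distr \<mu> borel f"
    unfolding \<pi>'_def \<pi>_eq(1) by (subst (1 2) distr_distr) (auto simp: o_def)
  moreover have "distr \<pi>' borel snd = \<nu>"
    unfolding \<pi>'_def \<pi>_eq(2) by (subst distr_distr) (auto simp: o_def)
  moreover have "prob_space \<pi>'"
    unfolding \<pi>'_def by (rule prob_space.prob_space_distr[OF coupling_prob_space[OF \<pi>]]) simp
  ultimately show "coupling (distr \<mu> borel f) \<nu> \<pi>'"
    by (simp add: coupling_def \<pi>'_def)
  show "cross_moment \<pi>' = integral\<^sup>L \<pi> (\<lambda>z. f (fst z) \<bullet> snd z)"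
    unfolding cross_moment_def \<pi>'_def by (subst integral_distr) auto
qed

lemma W2sq_le:
  assumes "\<mu> \<in> P2" "\<nu> \<in> P2" "coupling \<mu> \<nu> \<pi>"
  shows "W2sq \<mu> \<nu> \<le> second_moment \<mu> + second_moment \<nu> - 2 * cross_moment \<pi>"
  using W2sq_le_cost[OF assms(3)] integral_cost[OF assms] by simp

lemma optimal_cross_moment:
  fixes \<mu> \<nu> :: "'a::euclidean_space measure"
  assumes "\<mu> \<in> P2" "\<nu> \<in> P2"
  obtains \<pi> where "coupling \<mu> \<nu> \<pi>"
    "W2sq \<mu> \<nu> = second_moment \<mu> + second_moment \<nu> - 2 * cross_moment \<pi>"
proof -
  obtain \<pi> where "coupling \<mu> \<nu> \<pi>" "W2sq \<mu> \<nu> = integral\<^sup>L \<pi> (\<lambda>(x, y). (norm (x - y))\<^sup>2)"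
    by (rule optimal_coupling_exists[OF assms])
  with integral_cost[OF assms] show thesis by (intro that[of \<pi>]) simp_all
qed

lemma
  fixes \<mu> :: "'a::euclidean_space measure"
  assumes \<mu>: "\<mu> \<in> P2"
  shows scale_P2: "distr \<mu> borel (\<lambda>x. l *\<^sub>R x) \<in> P2"
    and second_moment_scale: "second_moment (distr \<mu> borel (\<lambda>x. l *\<^sub>R x)) = l\<^sup>2 * second_moment \<mu>"
    and bary_scale: "bary (distr \<mu> borel (\<lambda>x. l *\<^sub>R x)) = l *\<^sub>R bary \<mu>"
proof -
  note P = P2D[OF \<mu>]
  have m: "(\<lambda>x. l *\<^sub>R x) \<in> borel_measurable (borel :: 'a measure)"
    by (rule borel_measurable_scaleR) simp_all
  show "distr \<mu> borel (\<lambda>x. l *\<^sub>R x) \<in> P2"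
    by (rule P2_distr[OF P(1,2) m]) (simp add: power_mult_distrib P(3))
  show "second_moment (distr \<mu> borel (\<lambda>x. l *\<^sub>R x)) = l\<^sup>2 * second_moment \<mu>"
    unfolding second_moment_distr[OF P(2) m] by (simp add: power_mult_distrib second_moment_def)
  show "bary (distr \<mu> borel (\<lambda>x. l *\<^sub>R x)) = l *\<^sub>R bary \<mu>"
    unfolding bary_distr[OF P(2) m] by (simp add: bary_def)
qed

lemma coupling_scale:
  assumes \<pi>: "coupling \<mu> \<nu> \<pi>"
  shows "\<exists>\<pi>'. coupling (distr \<mu> borel (\<lambda>x. l *\<^sub>R x)) \<nu> \<pi>' \<and> cross_moment \<pi>' = l * cross_moment \<pi>"
  by (intro exI conjI, rule coupling_map_fst[OF \<pi>], simp)
    (simp add: coupling_map_fst(2)[OF \<pi>], simp add: cross_moment_def)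

text \<open>The map is written \<open>x + - bary \<mu>\<close> to match the form
  \<open>x + k\<close> in \<open>transl_inv\<close>.\<close>

lemma
  assumes \<mu>: "\<mu> \<in> P2"
  shows centre_P2: "distr \<mu> borel (\<lambda>x. x + - bary \<mu>) \<in> P2"
    and second_moment_centre: "second_moment (distr \<mu> borel (\<lambda>x. x + - bary \<mu>)) =
      second_moment \<mu> - (norm (bary \<mu>))\<^sup>2"
    and bary_centre: "bary (distr \<mu> borel (\<lambda>x. x + - bary \<mu>)) = 0"
proof -
  note P = P2D[OF \<mu>]
  have m: "(\<lambda>x. x + - bary \<mu>) \<in> borel_measurable borel" by simp
  interpret \<mu>: prob_space \<mu> by (rule P(1))
  show "distr \<mu> borel (\<lambda>x. x + - bary \<mu>) \<in> P2"
    by (rule P2_distr[OF P(1,2) m]) (simp add: integrable_shift[OF \<mu>])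
  show "second_moment (distr \<mu> borel (\<lambda>x. x + - bary \<mu>)) = second_moment \<mu> - (norm (bary \<mu>))\<^sup>2"
    unfolding second_moment_distr[OF P(2) m] using Var_eq[OF \<mu>] by (simp add: Var_def)
  show "bary (distr \<mu> borel (\<lambda>x. x + - bary \<mu>)) = 0"
    unfolding bary_distr[OF P(2) m] using P(4) by (simp add: \<mu>.prob_space bary_def)
qed

text \<open>Centring subtracts the integral of \<open>bary \<mu> \<bullet> y\<close>, which depends
  on the second marginal only and vanishes when \<open>\<nu>\<close> is centred.\<close>

lemma coupling_centre:
  assumes \<mu>: "\<mu> \<in> P2" and \<nu>: "\<nu> \<in> P2" and \<pi>: "coupling \<mu> \<nu> \<pi>"
  shows "\<exists>\<pi>'. coupling (distr \<mu> borel (\<lambda>x. x + - bary \<mu>)) \<nu> \<pi>' \<and>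
    cross_moment \<pi>' = cross_moment \<pi> - bary \<mu> \<bullet> bary \<nu>"
proof -
  have m: "(\<lambda>x. x + - bary \<mu>) \<in> borel_measurable borel" by simp
  have snd: "integrable \<pi> (\<lambda>z. snd z)"
    by (rule coupling_integrable_snd[OF \<pi>, of "\<lambda>y. y", THEN iffD2, OF _ P2D(4)[OF \<nu>]]) simp
  have "integral\<^sup>L \<pi> (\<lambda>z. snd z) = bary \<nu>"
    unfolding bary_def by (rule coupling_integral_snd[OF \<pi>]) simp
  then have "integral\<^sup>L \<pi> (\<lambda>z. bary \<mu> \<bullet> snd z) = bary \<mu> \<bullet> bary \<nu>"
    using integral_inner_right[OF snd, of "bary \<mu>"] by (simp only:)
  moreover have "integral\<^sup>L \<pi> (\<lambda>z. fst z \<bullet> snd z - bary \<mu> \<bullet> snd z) =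
      integral\<^sup>L \<pi> (\<lambda>z. fst z \<bullet> snd z) - integral\<^sup>L \<pi> (\<lambda>z. bary \<mu> \<bullet> snd z)"
    by (rule Bochner_Integration.integral_diff[OF integrable_cross[OF \<mu> \<nu> \<pi>]
        integrable_inner_right[OF snd]])
  ultimately have "integral\<^sup>L \<pi> (\<lambda>z. (fst z + - bary \<mu>) \<bullet> snd z) =
      cross_moment \<pi> - bary \<mu> \<bullet> bary \<nu>"
    by (simp only: cross_moment_def inner_diff_left add_uminus_conv_diff)
  with coupling_map_fst[OF \<pi> m]
  show "\<exists>\<pi>'. coupling (distr \<mu> borel (\<lambda>x. x + - bary \<mu>)) \<nu> \<pi>' \<and>
      cross_moment \<pi>' = cross_moment \<pi> - bary \<mu> \<bullet> bary \<nu>"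
    by metis
qed

text \<open>With \<open>bary \<nu> = 0\<close> the integrand is \<open>x \<bullet> y\<close> minus
  the squared norm of \<open>x\<close>, integrable under every coupling.\<close>

lemma kdom_iff:
  assumes \<mu>: "\<mu> \<in> P2" and \<nu>: "\<nu> \<in> P20"
  shows "kdom \<mu> \<nu> \<longleftrightarrow> (\<exists>\<pi>. coupling \<mu> \<nu> \<pi> \<and> cross_moment \<pi> = second_moment \<mu>)"
proof -
  have \<nu>2: "\<nu> \<in> P2" and b: "bary \<nu> = 0" using \<nu> by (auto simp: P20_def)
  have "integrable \<pi> (\<lambda>(x, y). inner (x - bary \<nu>) (y - x))"
    "integral\<^sup>L \<pi> (\<lambda>(x, y). inner (x - bary \<nu>) (y - x)) = cross_moment \<pi> - second_moment \<mu>"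
    if \<pi>: "coupling \<mu> \<nu> \<pi>" for \<pi>
  proof -
    have eq: "(\<lambda>(x, y). inner (x - bary \<nu>) (y - x)) = (\<lambda>z. fst z \<bullet> snd z - (norm (fst z))\<^sup>2)"
      by (auto simp: fun_eq_iff b inner_diff_right power2_norm_eq_inner)
    have int: "integrable \<pi> (\<lambda>z. (norm (fst z))\<^sup>2)"
      using P2D(3)[OF \<mu>] by (simp add: coupling_integrable_fst[OF \<pi>, where g = "\<lambda>x. (norm x)\<^sup>2"])
    show "integrable \<pi> (\<lambda>(x, y). inner (x - bary \<nu>) (y - x))"
      unfolding eq using integrable_cross[OF \<mu> \<nu>2 \<pi>] int by simp
    show "integral\<^sup>L \<pi> (\<lambda>(x, y). inner (x - bary \<nu>) (y - x)) = cross_moment \<pi> - second_moment \<mu>"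
      unfolding eq using integrable_cross[OF \<mu> \<nu>2 \<pi>] int
      by (simp add: cross_moment_def second_moment_def coupling_integral_fst[OF \<pi>, where g = "\<lambda>x. (norm x)\<^sup>2"])
  qed
  then show ?thesis unfolding kdom_def by auto
qed

text \<open>A vanishing second moment forces \<open>x = 0\<close> almost everywhere. This is the
  degenerate case of the scaling factor \<open>s / m\<close> used below.\<close>

lemma cross_moment_eq_0:
  assumes \<mu>: "\<mu> \<in> P2" and \<pi>: "coupling \<mu> \<nu> \<pi>" and "second_moment \<mu> = 0"
  shows "cross_moment \<pi> = 0"
proof -
  have int: "integrable \<pi> (\<lambda>z. (norm (fst z))\<^sup>2)"
    using P2D(3)[OF \<mu>] by (simp add: coupling_integrable_fst[OF \<pi>, where g = "\<lambda>x. (norm x)\<^sup>2"])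
  have "integral\<^sup>L \<pi> (\<lambda>z. (norm (fst z))\<^sup>2) = 0"
    using assms(3) coupling_integral_fst[OF \<pi>, of "\<lambda>x. (norm x)\<^sup>2"] by (simp add: second_moment_def)
  then have "AE z in \<pi>. (norm (fst z))\<^sup>2 = 0"
    using integral_nonneg_eq_0_iff_AE[OF int] by simp
  then have "AE z in \<pi>. fst z \<bullet> snd z = 0" by eventually_elim simp
  then show ?thesis unfolding cross_moment_def by (rule integral_eq_zero_AE)
qed

text \<open>By Fubini the independent coupling has cross moment 0 as \<open>\<nu>\<close> is
  centred, and the optimal one does no worse. This keeps the scaling factor \<open>s / m\<close>
  nonnegative, as a cone demands.\<close>

lemma optimal_cross_moment_nonneg:
  assumes \<mu>: "\<mu> \<in> P2" and \<nu>: "\<nu> \<in> P20"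
    and W: "W2sq \<mu> \<nu> = second_moment \<mu> + second_moment \<nu> - 2 * s"
  shows "0 \<le> s"
proof -
  have \<nu>2: "\<nu> \<in> P2" and b: "bary \<nu> = 0" using \<nu> by (auto simp: P20_def)
  note P = P2D[OF \<mu>] and N = P2D[OF \<nu>2]
  interpret \<mu>: prob_space \<mu> by (rule P(1))
  interpret \<nu>: prob_space \<nu> by (rule N(1))
  interpret pair_prob_space \<mu> \<nu> ..
  have \<pi>: "coupling \<mu> \<nu> (\<mu> \<Otimes>\<^sub>M \<nu>)" using coupling_pair_measure P N by blast
  have "integral\<^sup>L (\<mu> \<Otimes>\<^sub>M \<nu>) (\<lambda>z. fst z \<bullet> snd z) = (\<integral>x. (\<integral>y. x \<bullet> y \<partial>\<nu>) \<partial>\<mu>)"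
    using integral_fst'[OF integrable_cross[OF \<mu> \<nu>2 \<pi>]] by simp
  also have "\<dots> = 0"
    using N(4) b by (simp add: bary_def)
  finally have "cross_moment (\<mu> \<Otimes>\<^sub>M \<nu>) = 0" by (simp add: cross_moment_def)
  with W2sq_le[OF \<mu> \<nu>2 \<pi>] W show ?thesis by simp
qed

section \<open>Transport cost against variance on a cone\<close>

lemma W2sq_le_if_kdom:
  assumes \<mu>: "\<mu> \<in> P2" and \<nu>: "\<nu> \<in> P20" and "kdom \<mu> \<nu>"
  shows "W2sq \<mu> \<nu> \<le> Var \<nu> - Var \<mu>"
proof -
  have \<nu>2: "\<nu> \<in> P2" and b: "bary \<nu> = 0" using \<nu> by (auto simp: P20_def)
  obtain \<pi> where "coupling \<mu> \<nu> \<pi>" "cross_moment \<pi> = second_moment \<mu>"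
    using assms(3) unfolding kdom_iff[OF \<mu> \<nu>] by blast
  then have "W2sq \<mu> \<nu> \<le> second_moment \<nu> - second_moment \<mu>"
    using W2sq_le[OF \<mu> \<nu>2] by fastforce
  moreover have "Var \<nu> = second_moment \<nu>" "Var \<mu> \<le> second_moment \<mu>"
    using Var_eq[OF \<nu>2] Var_eq[OF \<mu>] b by auto
  ultimately show ?thesis by simp
qed

text \<open>The minimizer is varied inside \<open>D\<close>: stationarity under scaling yields
  dominance, and comparison with the centred measure yields zero mean.\<close>

lemma W2sq_minimizer:
  fixes \<nu> :: "'a::euclidean_space measure"
  assumes \<nu>: "\<nu> \<in> P20" and D: "D \<subseteq> P2" "is_cone D" "transl_inv D \<or> D \<subseteq> P20"
    and \<mu>: "\<mu> \<in> D" and min: "\<And>\<eta>. \<eta> \<in> D \<Longrightarrow> W2sq \<mu> \<nu> \<le> W2sq \<eta> \<nu>"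
  shows "kdom \<mu> \<nu>" "W2sq \<mu> \<nu> = Var \<nu> - Var \<mu>"
proof -
  have \<nu>2: "\<nu> \<in> P2" and b: "bary \<nu> = 0" using \<nu> by (auto simp: P20_def)
  have \<mu>2: "\<mu> \<in> P2" using \<mu> D by blast
  obtain \<pi> where \<pi>: "coupling \<mu> \<nu> \<pi>"
    and W: "W2sq \<mu> \<nu> = second_moment \<mu> + second_moment \<nu> - 2 * cross_moment \<pi>"
    using optimal_cross_moment[OF \<mu>2 \<nu>2] .
  define m where "m = second_moment \<mu>"
  define s where "s = cross_moment \<pi>"
  \<comment> \<open>The scaled optimal coupling is admissible for the scaled measure, so its cost
    bounds the minimum from above.\<close>
  have quad: "m - 2 * s \<le> l\<^sup>2 * m - 2 * (l * s)" if "0 \<le> l" for l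
  proof -
    let ?\<eta> = "distr \<mu> borel (\<lambda>x. l *\<^sub>R x)"
    obtain \<pi>' where \<pi>': "coupling ?\<eta> \<nu> \<pi>'" "cross_moment \<pi>' = l * s"
      using coupling_scale[OF \<pi>] unfolding s_def by blast
    have "?\<eta> \<in> D" using D(2) \<mu> that by (auto simp: is_cone_def)
    from min[OF this] W2sq_le[OF scale_P2[OF \<mu>2] \<nu>2 \<pi>'(1)]
    show ?thesis
      using W by (simp add: second_moment_scale[OF \<mu>2] \<pi>'(2) m_def s_def)
  qed
  txt \<open>The quadratic in the scaling factor has its minimum over the half line at 1,
    an interior point.\<close>
  have "m = s"
  proof -
    define q where "q l = l\<^sup>2 * m - 2 * (l * s)" for l
    have "(q has_real_derivative 2 * m - 2 * s) (at 1)"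
      unfolding q_def by (auto intro!: derivative_eq_intros)
    moreover have "q 1 \<le> q l" if "\<bar>1 - l\<bar> < 1" for l
      using quad[of l] that by (simp add: q_def)
    ultimately have "2 * m - 2 * s = 0"
      by (intro DERIV_local_min[of q _ 1 1]) auto
    then show ?thesis by simp
  qed
  then show "kdom \<mu> \<nu>"
    unfolding kdom_iff[OF \<mu>2 \<nu>] using \<pi> by (auto simp: m_def s_def)
  have "bary \<mu> = 0"
    using D(3)
  proof
    assume "transl_inv D"
    \<comment> \<open>Centring keeps the cross moment and lowers the second moment by the squared
      norm of the barycentre, which minimality forces to be 0.\<close>
    let ?\<eta> = "distr \<mu> borel (\<lambda>x. x + - bary \<mu>)"
    obtain \<pi>' where \<pi>': "coupling ?\<eta> \<nu> \<pi>'" "cross_moment \<pi>' = s"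
      using coupling_centre[OF \<mu>2 \<nu>2 \<pi>] b unfolding s_def by auto
    have "?\<eta> \<in> D" using \<open>transl_inv D\<close> \<mu> unfolding transl_inv_def by blast
    from min[OF this] W2sq_le[OF centre_P2[OF \<mu>2] \<nu>2 \<pi>'(1)]
    have "(norm (bary \<mu>))\<^sup>2 \<le> 0"
      using W unfolding second_moment_centre[OF \<mu>2] \<pi>'(2) s_def by linarith
    then show ?thesis by simp
  qed (use \<mu> in \<open>auto simp: P20_def\<close>)
  then show "W2sq \<mu> \<nu> = Var \<nu> - Var \<mu>"
    using W \<open>m = s\<close> b by (simp add: Var_eq[OF \<mu>2] Var_eq[OF \<nu>2] m_def s_def)
qed

text \<open>Centring \<open>\<eta>\<close> and then scaling it by the best factor never raises the
  cost, and the outcome is dominated.\<close>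

lemma exists_kdom_lower_bound:
  fixes \<nu> :: "'a::euclidean_space measure"
  assumes \<nu>: "\<nu> \<in> P20" and D: "D \<subseteq> P2" "is_cone D" "transl_inv D \<or> D \<subseteq> P20"
    and \<eta>: "\<eta> \<in> D"
  shows "\<exists>\<mu>\<in>D. kdom \<mu> \<nu> \<and> Var \<nu> - Var \<mu> \<le> W2sq \<eta> \<nu>"
proof -
  have \<nu>2: "\<nu> \<in> P2" and b: "bary \<nu> = 0" using \<nu> by (auto simp: P20_def)
  have \<eta>2: "\<eta> \<in> P2" using \<eta> D by blast
  have "\<exists>\<xi>\<in>D. bary \<xi> = 0 \<and> W2sq \<xi> \<nu> \<le> W2sq \<eta> \<nu>"
    using D(3)
  proof
    assume "transl_inv D"
    let ?\<xi> = "distr \<eta> borel (\<lambda>x. x + - bary \<eta>)"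
    obtain \<pi> where \<pi>: "coupling \<eta> \<nu> \<pi>"
      and W: "W2sq \<eta> \<nu> = second_moment \<eta> + second_moment \<nu> - 2 * cross_moment \<pi>"
      using optimal_cross_moment[OF \<eta>2 \<nu>2] .
    obtain \<pi>' where \<pi>': "coupling ?\<xi> \<nu> \<pi>'" "cross_moment \<pi>' = cross_moment \<pi>"
      using coupling_centre[OF \<eta>2 \<nu>2 \<pi>] b by auto
    have "W2sq ?\<xi> \<nu> \<le> W2sq \<eta> \<nu> - (norm (bary \<eta>))\<^sup>2"
      using W2sq_le[OF centre_P2[OF \<eta>2] \<nu>2 \<pi>'(1)] W
      unfolding second_moment_centre[OF \<eta>2] \<pi>'(2) by simp
    then have "W2sq ?\<xi> \<nu> \<le> W2sq \<eta> \<nu>" by (rule order_trans) simp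
    moreover have "?\<xi> \<in> D" using \<open>transl_inv D\<close> \<eta> unfolding transl_inv_def by blast
    ultimately show ?thesis using bary_centre[OF \<eta>2] by blast
  qed (use \<eta> in \<open>auto simp: P20_def\<close>)
  then obtain \<xi> where \<xi>: "\<xi> \<in> D" "bary \<xi> = 0" "W2sq \<xi> \<nu> \<le> W2sq \<eta> \<nu>" by blast
  have \<xi>2: "\<xi> \<in> P2" using \<xi> D by blast
  obtain \<pi> where \<pi>: "coupling \<xi> \<nu> \<pi>"
    and W: "W2sq \<xi> \<nu> = second_moment \<xi> + second_moment \<nu> - 2 * cross_moment \<pi>"
    using optimal_cross_moment[OF \<xi>2 \<nu>2] .
  define m where "m = second_moment \<xi>"
  define s where "s = cross_moment \<pi>"
  have m: "0 \<le> m" unfolding m_def by (rule second_moment_nonneg)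
  have s: "0 \<le> s" using optimal_cross_moment_nonneg[OF \<xi>2 \<nu> W] by (simp add: s_def)
  have s0: "s = 0" if "m = 0"
    using cross_moment_eq_0[OF \<xi>2 \<pi>] that by (simp add: m_def s_def)
  \<comment> \<open>The vertex of the quadratic \<open>l\<^sup>2 * m - 2 * (l * s)\<close>. If
    \<open>m = 0\<close>, division by zero gives \<open>l = 0\<close>, and \<open>s0\<close> keeps
    \<open>l * m = s\<close> true.\<close>
  define l where "l = s / m"
  have l: "0 \<le> l" "l * m = s" using m s s0 by (auto simp: l_def)
  let ?\<mu> = "distr \<xi> borel (\<lambda>x. l *\<^sub>R x)"
  have \<mu>D: "?\<mu> \<in> D" using D(2) \<xi>(1) l(1) by (auto simp: is_cone_def)
  have \<mu>2: "?\<mu> \<in> P2" by (rule scale_P2[OF \<xi>2])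
  have mom: "second_moment ?\<mu> = l * s"
    using l(2) by (simp add: second_moment_scale[OF \<xi>2] power2_eq_square mult.assoc flip: m_def)
  have "kdom ?\<mu> \<nu>"
    unfolding kdom_iff[OF \<mu>2 \<nu>] mom using coupling_scale[OF \<pi>, of l] by (simp add: s_def)
  moreover have "Var ?\<mu> = l * s"
    by (simp add: Var_eq[OF \<mu>2] mom bary_scale[OF \<xi>2] \<xi>(2))
  \<comment> \<open>Completing the square: this is the cost of the coupling \<open>\<pi>\<close>
    minus that of its scaled version.\<close>
  moreover have "0 \<le> m * (l - 1)\<^sup>2" using m by simp
  then have "0 \<le> m + l * s - 2 * s"
    using l(2) by (simp add: power2_eq_square algebra_simps)
  then have "Var \<nu> - l * s \<le> W2sq \<xi> \<nu>"
    using W b by (simp add: Var_eq[OF \<nu>2] m_def s_def)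
  then have "Var \<nu> - l * s \<le> W2sq \<eta> \<nu>" using \<xi>(3) by (rule order_trans)
  ultimately show ?thesis using \<mu>D by (intro bexI[of _ ?\<mu>]) simp_all
qed

theorem mainTheorem14:
  fixes \<nu> :: "('a::euclidean_space) measure" and D :: "'a measure set"
  assumes "\<nu> \<in> P20"
    and "D \<subseteq> P2"
    and "is_cone D"
    and "transl_inv D \<or> D \<subseteq> P20"
  shows "argmax_on Var (D \<inter> MK \<nu>) = argmin_on (\<lambda>\<mu>. W2sq \<mu> \<nu>) D
    \<and> ((argmin_on (\<lambda>\<mu>. W2sq \<mu> \<nu>) D \<noteq> {} \<or> argmax_on Var (D \<inter> MK \<nu>) \<noteq> {})
        \<longrightarrow> (INF \<mu>\<in>D. W2sq \<mu> \<nu>) = Var \<nu> - (SUP \<mu>\<in>D \<inter> MK \<nu>. Var \<mu>))"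
proof -
  have MK: "\<mu> \<in> D \<inter> MK \<nu> \<longleftrightarrow> \<mu> \<in> D \<and> kdom \<mu> \<nu>" for \<mu>
    using assms(2) by (auto simp: MK_def)
  have upper: "W2sq \<mu> \<nu> \<le> Var \<nu> - Var \<mu>" if "\<mu> \<in> D \<inter> MK \<nu>" for \<mu>
    using W2sq_le_if_kdom[OF _ assms(1)] that assms(2) unfolding MK by blast
  have min: "\<mu> \<in> D \<inter> MK \<nu> \<and> W2sq \<mu> \<nu> = Var \<nu> - Var \<mu>"
    if "\<mu> \<in> argmin_on (\<lambda>\<mu>. W2sq \<mu> \<nu>) D" for \<mu>
  proof -
    have "\<mu> \<in> D" "\<And>\<eta>. \<eta> \<in> D \<Longrightarrow> W2sq \<mu> \<nu> \<le> W2sq \<eta> \<nu>"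
      using that by (auto simp: argmin_on_def)
    from W2sq_minimizer[OF assms this] this(1) show ?thesis unfolding MK by blast
  qed
  have eq: "argmax_on Var (D \<inter> MK \<nu>) = argmin_on (\<lambda>\<mu>. W2sq \<mu> \<nu>) D"
  proof (intro equalityI subsetI)
    fix \<mu> assume "\<mu> \<in> argmax_on Var (D \<inter> MK \<nu>)"
    then have \<mu>: "\<mu> \<in> D \<inter> MK \<nu>" and max: "\<And>\<eta>. \<eta> \<in> D \<inter> MK \<nu> \<Longrightarrow> Var \<eta> \<le> Var \<mu>"
      by (auto simp: argmax_on_def)
    have "W2sq \<mu> \<nu> \<le> W2sq \<eta> \<nu>" if \<eta>: "\<eta> \<in> D" for \<eta>
    proof -
      obtain \<xi> where "\<xi> \<in> D \<inter> MK \<nu>" "Var \<nu> - Var \<xi> \<le> W2sq \<eta> \<nu>"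
        using exists_kdom_lower_bound[OF assms \<eta>] unfolding MK by blast
      \<comment> \<open>The chain is \<open>W2sq \<mu> \<nu> \<le> Var \<nu> - Var \<mu> \<le> Var
        \<nu> - Var \<xi> \<le> W2sq \<eta> \<nu>\<close>.\<close>
      then show ?thesis using upper[OF \<mu>] max[of \<xi>] by linarith
    qed
    then show "\<mu> \<in> argmin_on (\<lambda>\<mu>. W2sq \<mu> \<nu>) D"
      using \<mu> by (auto simp: argmin_on_def)
  next
    fix \<mu> assume \<mu>: "\<mu> \<in> argmin_on (\<lambda>\<mu>. W2sq \<mu> \<nu>) D"
    have "Var \<eta> \<le> Var \<mu>" if "\<eta> \<in> D \<inter> MK \<nu>" for \<eta>
    proof -
      have "W2sq \<mu> \<nu> \<le> W2sq \<eta> \<nu>" using \<mu> that by (auto simp: argmin_on_def)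
      \<comment> \<open>The chain is \<open>Var \<eta> \<le> Var \<nu> - W2sq \<eta> \<nu> \<le> Var
        \<nu> - W2sq \<mu> \<nu> = Var \<mu>\<close>.\<close>
      then show ?thesis using upper[OF that] min[OF \<mu>] by linarith
    qed
    then show "\<mu> \<in> argmax_on Var (D \<inter> MK \<nu>)"
      using min[OF \<mu>] by (auto simp: argmax_on_def)
  qed
  \<comment> \<open>Both extrema are attained at the same \<open>\<mu>\<close>, so the infimum and
    the supremum are values there.\<close>
  moreover have "(INF \<mu>\<in>D. W2sq \<mu> \<nu>) = Var \<nu> - (SUP \<mu>\<in>D \<inter> MK \<nu>. Var \<mu>)"
    if \<mu>: "\<mu> \<in> argmin_on (\<lambda>\<mu>. W2sq \<mu> \<nu>) D" for \<mu>
  proof -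
    have "(INF \<mu>\<in>D. W2sq \<mu> \<nu>) = W2sq \<mu> \<nu>"
      using \<mu> by (intro cInf_eq_minimum) (auto simp: argmin_on_def)
    moreover have "\<mu> \<in> argmax_on Var (D \<inter> MK \<nu>)" using \<mu> eq by simp
    then have "(SUP \<mu>\<in>D \<inter> MK \<nu>. Var \<mu>) = Var \<mu>"
      by (intro cSup_eq_maximum) (auto simp: argmax_on_def)
    ultimately show ?thesis using min[OF \<mu>] by simp
  qed
  ultimately show ?thesis by blast
qed

end
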